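(* Let $\eta>0$, $\rho>0$, $\mu\in\mathbb R$, and for $q>0$ let $b(\cdot;q)$ (for $\mu>0$) and $V(\cdot,\cdot;q)$ be as in the context; let $V_0$ and $b_\circ$ be the value function and threshold of the classical problem ($q=0$) as in the context. Then $$\lim_{q\downarrow0}b(i;q)=b_\circ\quad\text{for all } i\ge0\ (\text{when }\mu>0),\qquad \lim_{q\downarrow0}V(x,i;q)=V_0(x)\quad\text{for all }(x,i)\in\mathcal M^0.$$
   Context: $\mathcal M^0=\{(x,i)\in\mathbb R^2:x\ge i\ge0\}$. $\alpha<0<\beta$ are the roots of $\tfrac12\eta^2\theta^2+\mu\theta-\rho=0$. Case $\mu\le0$: $V_0(x)=x$ and $V(x,i;q)=e^{-qi}\big(x-i-\frac1q\big)+\frac1q$. Case $\mu>0$: $b_\circ=\frac1{\alpha-\beta}\ln\big(\frac{\beta^2}{\alpha^2}\big)>0$; $$V_0(x)=\begin{cases}-\frac{\beta}{\alpha(\alpha-\beta)}e^{\alpha(x-b_\circ)}+\frac{\alpha}{\beta(\alpha-\beta)}e^{\beta(x-b_\circ)},&0\le x<b_\circ,\\ x-b_\circ+\frac\mu\rho,&x\ge b_\circ.\end{cases}$$ For $q>0$, $b(\cdot)=b(\cdot;q):[0,\infty)\to\mathbb R$ is the unique (strictly decreasing) solution of $$b'(i)=\frac{q}{\alpha\beta}\cdot\frac{\alpha^2e^{\beta(i-b(i))}-\beta^2e^{\alpha(i-b(i))}}{\beta e^{\alpha(i-b(i))}-\alpha e^{\beta(i-b(i))}},\quad i>0,\qquad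 b(0)=b_\circ,$$ $i^\star=i^\star(q)\in(0,b_\circ)$ is the unique solution of $b(i;q)=i$, and $$V(x,i;q)=\begin{cases}\frac{1}{\alpha-\beta}e^{-qi}\Big(\frac{\alpha}{\beta}e^{\beta(x-b(i))}-\frac{\beta}{\alpha}e^{\alpha(x-b(i))}\Big),&0\le i\le x<b(i),\\[2pt] e^{-qi}\big(x-b(i)+\frac{\mu}{\rho}\big),&x\ge b(i)>i,\ 0\le i<i^\star,\\[2pt] e^{-qi}\big(x-i-\frac1q\big)+\big(\frac1q+\frac\mu\rho\big)e^{-qi^\star},&x\ge i\ge b(i),\ i\ge i^\star.\end{cases}$$ (In both cases $V(\cdot,\cdot;q)$ is the value function of the problem of maximising the expected dividends discounted by $e^{-\rho t-qI_t}$, with $I$ the running infimum of the controlled surplus with drift $\mu$ and volatility $\eta$, until its first hitting time of $0$; $V_0$ is the corresponding value function for $q=0$.) *)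

theory Defs
  imports "HOL-Analysis.Analysis"
begin

definition state_space :: "(real \<times> real) set" where
  "state_space = {(x, i). x \<ge> i \<and> i \<ge> 0}"

definition char_poly :: "real \<Rightarrow> real \<Rightarrow> real \<Rightarrow> real \<Rightarrow> real" where
  "char_poly \<mu> \<eta> \<rho> \<theta> = 1/2 * \<eta>\<^sup>2 * \<theta>\<^sup>2 + \<mu> * \<theta> - \<rho>"

definition neg_root :: "real \<Rightarrow> real \<Rightarrow> real \<Rightarrow> real" where
  "neg_root \<mu> \<eta> \<rho> = (THE \<theta>. \<theta> < 0 \<and> char_poly \<mu> \<eta> \<rho> \<theta> = 0)"

definition pos_root :: "real \<Rightarrow> real \<Rightarrow> real \<Rightarrow> real" where
  "pos_root \<mu> \<eta> \<rho> = (THE \<theta>. \<theta> > 0 \<and> char_poly \<mu> \<eta> \<rho> \<theta> = 0)"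

definition classical_threshold :: "real \<Rightarrow> real \<Rightarrow> real \<Rightarrow> real" where
  "classical_threshold \<mu> \<eta> \<rho> =
    (let \<alpha> = neg_root \<mu> \<eta> \<rho>; \<beta> = pos_root \<mu> \<eta> \<rho>
     in 1 / (\<alpha> - \<beta>) * ln (\<beta>\<^sup>2 / \<alpha>\<^sup>2))"

definition classical_value :: "real \<Rightarrow> real \<Rightarrow> real \<Rightarrow> real \<Rightarrow> real" where
  "classical_value \<mu> \<eta> \<rho> x =
    (let \<alpha> = neg_root \<mu> \<eta> \<rho>; \<beta> = pos_root \<mu> \<eta> \<rho>; b\<^sub>0 = classical_threshold \<mu> \<eta> \<rho>
     in if \<mu> \<le> 0 then x
        else if x < b\<^sub>0 then
          - (\<beta> / (\<alpha> * (\<alpha> - \<beta>))) * exp (\<alpha> * (x - b\<^sub>0))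
          + \<alpha> / (\<beta> * (\<alpha> - \<beta>)) * exp (\<beta> * (x - b\<^sub>0))
        else x - b\<^sub>0 + \<mu> / \<rho>)"

text \<open>
  A function on \<open>[0, \<infinity>)\<close> is represented by a total function that is \<open>undefined\<close> at negative
  arguments (\<open>extensional\<close>), so that uniqueness of the solution on \<open>[0, \<infinity>)\<close> makes the
  definite description of \<open>boundary\<close> meaningful. As the differential equation is imposed
  for \<open>i > 0\<close> only, continuity is what ties the solution to its initial value. That the
  solution is strictly decreasing is a consequence and not part of the definition.
\<close>

definition boundary_solution ::
    "real \<Rightarrow> real \<Rightarrow> real \<Rightarrow> real \<Rightarrow> (real \<Rightarrow> real) \<Rightarrow> bool" where
  "boundary_solution \<mu> \<eta> \<rho> q b \<longleftrightarrow>
    (let \<alpha> = neg_root \<mu> \<eta> \<rho>; \<beta> = pos_root \<mu> \<eta> \<rho>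
     in b \<in> extensional {0..} \<and> continuous_on {0..} b \<and>
        b 0 = classical_threshold \<mu> \<eta> \<rho> \<and>
        (\<forall>i>0. (b has_real_derivative
           q / (\<alpha> * \<beta>) *
           ((\<alpha>\<^sup>2 * exp (\<beta> * (i - b i)) - \<beta>\<^sup>2 * exp (\<alpha> * (i - b i))) /
            (\<beta> * exp (\<alpha> * (i - b i)) - \<alpha> * exp (\<beta> * (i - b i))))) (at i)))"

definition boundary :: "real \<Rightarrow> real \<Rightarrow> real \<Rightarrow> real \<Rightarrow> real \<Rightarrow> real" where
  "boundary \<mu> \<eta> \<rho> q = (THE b. boundary_solution \<mu> \<eta> \<rho> q b)"

definition i_star :: "real \<Rightarrow> real \<Rightarrow> real \<Rightarrow> real \<Rightarrow> real" where
  "i_star \<mu> \<eta> \<rho> q =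
    (THE i. i \<in> {0<..<classical_threshold \<mu> \<eta> \<rho>} \<and> boundary \<mu> \<eta> \<rho> q i = i)"

text \<open>
  For \<open>\<mu> > 0\<close> the three regions cover \<open>state_space\<close>; the last branch is never taken there.
\<close>

definition value_fn ::
    "real \<Rightarrow> real \<Rightarrow> real \<Rightarrow> real \<Rightarrow> real \<Rightarrow> real \<Rightarrow> real" where
  "value_fn \<mu> \<eta> \<rho> q x i =
    (let \<alpha> = neg_root \<mu> \<eta> \<rho>; \<beta> = pos_root \<mu> \<eta> \<rho>;
         b = boundary \<mu> \<eta> \<rho> q; s = i_star \<mu> \<eta> \<rho> q
     in if \<mu> \<le> 0 then exp (- q * i) * (x - i - 1 / q) + 1 / q
        else if 0 \<le> i \<and> i \<le> x \<and> x < b i then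
          1 / (\<alpha> - \<beta>) * exp (- q * i) *
          (\<alpha> / \<beta> * exp (\<beta> * (x - b i)) - \<beta> / \<alpha> * exp (\<alpha> * (x - b i)))
        else if x \<ge> b i \<and> b i > i \<and> 0 \<le> i \<and> i < s then
          exp (- q * i) * (x - b i + \<mu> / \<rho>)
        else if x \<ge> i \<and> i \<ge> b i \<and> i \<ge> s then
          exp (- q * i) * (x - i - 1 / q) + (1 / q + \<mu> / \<rho>) * exp (- q * s)
        else undefined)"

end

theory Submission
  imports Defs "HOL-Real_Asymp.Real_Asymp"
begin

text \<open>
  In terms of \<open>u i = i - b i\<close> the boundary equation is autonomous, \<open>u' = 1 - q g(u)\<close>, where \<open>g\<close>
  takes values strictly between \<open>- 1 / \<beta>\<close> and \<open>- 1 / \<alpha>\<close>. Hence for \<open>q < - \<alpha>\<close> the right-hand side is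
  positive and bounded, and separation of variables gives a unique global solution. Since \<open>u\<close>
  increases from \<open>- b\<^sub>0\<close>, the zero of \<open>g\<close>, one has \<open>- q / \<beta> < b' < 0\<close> and therefore
  \<open>b\<^sub>0 - q i / \<beta> \<le> b i \<le> b\<^sub>0\<close>; at the fixed point this also yields \<open>i_star \<rightarrow> b\<^sub>0\<close>. The value function
  then converges region by region.
\<close>

section \<open>Autonomous scalar equations with positive right-hand side\<close>

lemma separation_of_variables:
  fixes h :: "real \<Rightarrow> real"
  assumes "continuous_on UNIV h" and "\<And>u. 0 < h u"
  obtains F where "\<And>u. (F has_real_derivative 1 / h u) (at u)"
proof -
  \<comment> \<open>Infinite end points give one antiderivative on the whole line rather than one
    per compact interval.\<close>
  have "\<exists>F. \<forall>x::real. -\<infinity> < ereal x \<longrightarrow> ereal x < \<infinity> \<longrightarrow>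
      (F has_vector_derivative 1 / h x) (at x)"
  proof (rule einterval_antiderivative)
    fix x :: real
    have "isCont h x" using assms(1) by (simp add: continuous_on_eq_continuous_at)
    then show "isCont (\<lambda>x. 1 / h x) x" using assms(2)[of x] by (intro continuous_intros) auto
  qed simp
  then show ?thesis using that by (auto simp: has_real_derivative_iff_has_vector_derivative)
qed

text \<open>An antiderivative \<open>F\<close> of \<open>1 / h\<close> measures elapsed time. It is
  strictly increasing, and \<open>h u \<le> M\<close> makes it grow at rate at least
  \<open>1 / M\<close>, so it maps onto the real line: there is no blow-up in finite time. Its
  inverse \<open>G\<close> solves the equation, and a time shift by \<open>F c\<close> adjusts the
  initial value.\<close>

lemma autonomous_ode_solution:
  fixes h :: "real \<Rightarrow> real"
  assumes cont: "continuous_on UNIV h" and pos: "\<And>u. 0 < h u" and bound: "\<And>u. h u \<le> M"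
  obtains u where "u 0 = c" and "\<And>t. (u has_real_derivative h (u t)) (at t)"
proof -
  obtain F where F: "\<And>u. (F has_real_derivative 1 / h u) (at u)"
    using separation_of_variables[OF cont pos] by blast
  have M: "0 < M" using pos[of 0] bound[of 0] by linarith
  have inc: "F x < F y" if "x < y" for x y
    by (rule DERIV_pos_imp_increasing[OF that]) (use F pos in \<open>auto intro!: exI\<close>)
  have lower: "(y - x) / M \<le> F y - F x" if "x \<le> y" for x y
  proof -
    have "F x - x / M \<le> F y - y / M"
    proof (rule DERIV_nonneg_imp_nondecreasing[OF that])
      fix z
      have "((\<lambda>z. F z - z / M) has_real_derivative 1 / h z - 1 / M) (at z)"
        using M by (auto intro!: derivative_eq_intros F)
      moreover have "0 \<le> 1 / h z - 1 / M" using pos[of z] bound[of z] by (simp add: frac_le)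
      ultimately show "\<exists>d. ((\<lambda>z. F z - z / M) has_real_derivative d) (at z) \<and> 0 \<le> d" by blast
    qed
    then show ?thesis using M by (simp add: diff_divide_distrib)
  qed
  have contF: "continuous_on S F" for S
    using F by (auto intro!: continuous_at_imp_continuous_on DERIV_isCont)
  have surj: "\<exists>x. F x = y" for y
  proof -
    \<comment> \<open>By \<open>lower\<close>, moving from 0 to \<open>r\<close> or to
      \<open>- r\<close> changes \<open>F\<close> by at least \<open>\<bar>y - F 0\<bar>\<close>,
      which traps \<open>y\<close> between the two values.\<close>
    define r where "r = M * \<bar>y - F 0\<bar>"
    have r: "0 \<le> r" "r / M = \<bar>y - F 0\<bar>" using M by (auto simp: r_def)
    have "F (- r) \<le> y" "y \<le> F r" using lower[of "- r" 0] lower[of 0 r] r by auto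
    then show ?thesis using IVT'[of F "- r" y r] contF r(1) by auto
  qed
  define G where "G y = (THE x. F x = y)" for y
  have uniq: "\<exists>!x. F x = y" for y
    using surj inc by (metis linorder_neqE_linordered_idom order_less_irrefl)
  have FG: "F (G y) = y" for y unfolding G_def by (rule theI'[OF uniq])
  have GF: "G (F x) = x" for x using FG uniq by metis
  have dG: "(G has_real_derivative h (G y)) (at y)" for y
  proof -
    \<comment> \<open>The radius 1 here and the interval around \<open>y\<close> below are
      arbitrary, since \<open>F\<close> is invertible globally.\<close>
    have "isCont G (F (G y))"
      by (rule isCont_inverse_function[of 1]) (use GF F in \<open>auto intro: DERIV_isCont\<close>)
    then have "isCont G y" by (simp add: FG)
    then have "(G has_real_derivative inverse (1 / h (G y))) (at y)"
      using pos[of "G y"] F[of "G y"]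
      by (intro DERIV_inverse_function[where f = F and a = "y - 1" and b = "y + 1"]) (auto simp: FG)
    then show ?thesis by simp
  qed
  show ?thesis
  proof
    \<comment> \<open>The summand 0 stays visible so that unification reads off the witness
      \<open>\<lambda>t. G (t + F c)\<close>.\<close>
    show "G (0 + F c) = c" by (simp add: GF)
    show "((\<lambda>t. G (t + F c)) has_real_derivative h (G (t + F c))) (at t)" for t
      using dG[of "t + F c"] by (simp add: DERIV_shift)
  qed
qed

text \<open>Along every solution \<open>w\<close> the quantity \<open>F (w t) - t\<close> is
  constant, and \<open>F\<close> is injective, so the initial value determines \<open>w\<close>.
  Derivatives for positive times and continuity up to 0 match the form of
  \<open>boundary_solution\<close>.\<close>

lemma autonomous_ode_unique:
  fixes h u v :: "real \<Rightarrow> real"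
  assumes cont: "continuous_on UNIV h" and pos: "\<And>u. 0 < h u"
    and u: "continuous_on {0..} u" "\<And>t. 0 < t \<Longrightarrow> (u has_real_derivative h (u t)) (at t)"
    and v: "continuous_on {0..} v" "\<And>t. 0 < t \<Longrightarrow> (v has_real_derivative h (v t)) (at t)"
    and "u 0 = v 0" and "0 \<le> t"
  shows "u t = v t"
proof -
  obtain F where F: "\<And>u. (F has_real_derivative 1 / h u) (at u)"
    using separation_of_variables[OF cont pos] by blast
  have inc: "F x < F y" if "x < y" for x y
    by (rule DERIV_pos_imp_increasing[OF that]) (use F pos in \<open>auto intro!: exI\<close>)
  have contF: "continuous_on UNIV F"
    using F by (auto intro!: continuous_at_imp_continuous_on DERIV_isCont)
  have elapsed: "F (w t) = t + F (w 0)"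
    if "continuous_on {0..} w" "\<And>t. 0 < t \<Longrightarrow> (w has_real_derivative h (w t)) (at t)" "0 < t"
    for w :: "real \<Rightarrow> real" and t
  proof -
    have "F (w t) - t = F (w 0) - 0"
    proof (rule DERIV_isconst_end[OF \<open>0 < t\<close>])
      have "continuous_on {0..t} w" using that(1) by (rule continuous_on_subset) auto
      then show "continuous_on {0..t} (\<lambda>s. F (w s) - s)"
        by (intro continuous_intros continuous_on_compose2[OF contF]) auto
      fix s :: real assume "0 < s"
      then have "((\<lambda>s. F (w s)) has_real_derivative 1 / h (w s) * h (w s)) (at s)"
        using that(2) by (intro DERIV_chain2[OF F])
      then show "((\<lambda>s. F (w s) - s) has_real_derivative 0) (at s)"
        using pos[of "w s"] by (auto intro!: derivative_eq_intros)
    qed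
    then show ?thesis by simp
  qed
  show ?thesis
  proof (cases "t = 0")
    case False
    then have "F (u t) = F (v t)"
      using elapsed[OF u, of t] elapsed[OF v, of t] \<open>0 \<le> t\<close> \<open>u 0 = v 0\<close> by simp
    then show ?thesis using inc by (metis linorder_neqE_linordered_idom order_less_irrefl)
  qed (use \<open>u 0 = v 0\<close> in simp)
qed

section \<open>Characteristic roots and the slope of the boundary\<close>

lemma char_poly_roots:
  assumes "\<eta> > 0" and "\<rho> > 0"
  shows "neg_root \<mu> \<eta> \<rho> < 0" and "0 < pos_root \<mu> \<eta> \<rho>"
    and "\<mu> > 0 \<Longrightarrow> neg_root \<mu> \<eta> \<rho> + pos_root \<mu> \<eta> \<rho> < 0"
proof -
  define r where "r = sqrt (\<mu>\<^sup>2 + 2 * \<eta>\<^sup>2 * \<rho>)"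
  define A where "A = (- \<mu> - r) / \<eta>\<^sup>2"
  define B where "B = (- \<mu> + r) / \<eta>\<^sup>2"
  have "0 < \<eta>\<^sup>2 * \<rho>" using assms by simp
  then have "\<mu>\<^sup>2 < \<mu>\<^sup>2 + 2 * \<eta>\<^sup>2 * \<rho>" by linarith
  then have "\<bar>\<mu>\<bar> < r" unfolding r_def by (metis real_sqrt_abs real_sqrt_less_iff)
  then have sign: "A < 0" "0 < B"
    using assms unfolding A_def B_def by (auto simp: divide_neg_pos)
  have r2: "r\<^sup>2 = \<mu>\<^sup>2 + 2 * \<eta>\<^sup>2 * \<rho>" using assms unfolding r_def by simp
  have "A * \<eta>\<^sup>2 = - \<mu> - r" "B * \<eta>\<^sup>2 = - \<mu> + r" using assms by (auto simp: A_def B_def)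
  \<comment> \<open>The two Vieta relations, cleared of denominators. They yield the factorisation
    of \<open>char_poly\<close>, and the first also the sign of \<open>A + B\<close>.\<close>
  then have sum: "(A + B) * \<eta>\<^sup>2 = - 2 * \<mu>" by (simp add: algebra_simps)
  have prod: "\<eta>\<^sup>2 * A * B = - 2 * \<rho>"
  proof -
    have "(A * \<eta>\<^sup>2) * (B * \<eta>\<^sup>2) = (- \<mu> - r) * (- \<mu> + r)"
      using \<open>A * \<eta>\<^sup>2 = - \<mu> - r\<close> \<open>B * \<eta>\<^sup>2 = - \<mu> + r\<close> by simp
    also have "\<dots> = - 2 * \<rho> * \<eta>\<^sup>2" using r2 by (simp add: algebra_simps power2_eq_square)
    finally have "(\<eta>\<^sup>2 * A * B) * \<eta>\<^sup>2 = - 2 * \<rho> * \<eta>\<^sup>2" by (simp add: algebra_simps)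
    moreover have "\<eta>\<^sup>2 \<noteq> 0" using assms by simp
    ultimately show ?thesis using mult_right_cancel by blast
  qed
  have factor: "char_poly \<mu> \<eta> \<rho> \<theta> = 1/2 * \<eta>\<^sup>2 * ((\<theta> - A) * (\<theta> - B))" for \<theta>
    unfolding char_poly_def using sum prod by algebra
  have root: "char_poly \<mu> \<eta> \<rho> \<theta> = 0 \<longleftrightarrow> \<theta> = A \<or> \<theta> = B" for \<theta>
    using assms by (simp add: factor)
  have "neg_root \<mu> \<eta> \<rho> = A" "pos_root \<mu> \<eta> \<rho> = B"
    unfolding neg_root_def pos_root_def root using sign by (auto intro!: the_equality)
  moreover have "A + B < 0" if "\<mu> > 0"
  proof -
    have "(A + B) * \<eta>\<^sup>2 < 0" using sum that by simp
    then show ?thesis using assms by (simp add: mult_less_0_iff)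
  qed
  ultimately show "neg_root \<mu> \<eta> \<rho> < 0" "0 < pos_root \<mu> \<eta> \<rho>"
    "\<mu> > 0 \<Longrightarrow> neg_root \<mu> \<eta> \<rho> + pos_root \<mu> \<eta> \<rho> < 0"
    using sign by auto
qed

text \<open>This is the function \<open>g\<close> of the overview: the right-hand side of the
  boundary equation without its factor \<open>q\<close>, with \<open>u\<close> in place of
  \<open>i - b i\<close>.\<close>

definition boundary_slope :: "real \<Rightarrow> real \<Rightarrow> real \<Rightarrow> real" where
  "boundary_slope \<alpha> \<beta> u =
    1 / (\<alpha> * \<beta>) * ((\<alpha>\<^sup>2 * exp (\<beta> * u) - \<beta>\<^sup>2 * exp (\<alpha> * u)) / (\<beta> * exp (\<alpha> * u) - \<alpha> * exp (\<beta> * u)))"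

context
  fixes \<alpha> \<beta> :: real
  assumes \<alpha>: "\<alpha> < 0" and \<beta>: "0 < \<beta>"
begin

lemma boundary_slope_denominator_pos: "0 < \<beta> * exp (\<alpha> * u) - \<alpha> * exp (\<beta> * u)"
proof -
  have "0 < \<beta> * exp (\<alpha> * u)" "\<alpha> * exp (\<beta> * u) < 0" using \<alpha> \<beta> by (auto simp: mult_neg_pos)
  then show ?thesis by linarith
qed

lemma continuous_boundary_slope: "continuous_on UNIV (boundary_slope \<alpha> \<beta>)"
  unfolding boundary_slope_def
  by (intro continuous_intros) (use boundary_slope_denominator_pos in \<open>auto simp: less_le\<close>)

text \<open>The slope is a convex combination of \<open>- 1 / \<beta>\<close> and
  \<open>- 1 / \<alpha>\<close>, with the positive weights
  \<open>- \<alpha> * exp (\<beta> * u) / D\<close> and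
  \<open>\<beta> * exp (\<alpha> * u) / D\<close>. The proof computes the distance to each end
  point.\<close>

lemma boundary_slope_bounds:
  shows "- 1 / \<beta> < boundary_slope \<alpha> \<beta> u" and "boundary_slope \<alpha> \<beta> u < - 1 / \<alpha>"
proof -
  define D where "D = \<beta> * exp (\<alpha> * u) - \<alpha> * exp (\<beta> * u)"
  have D: "0 < D" unfolding D_def by (rule boundary_slope_denominator_pos)
  have "boundary_slope \<alpha> \<beta> u + 1 / \<beta> = exp (\<alpha> * u) * ((\<alpha> - \<beta>) / \<alpha>) / D"
    using D \<alpha> \<beta> unfolding boundary_slope_def D_def[symmetric]
    by (simp add: field_simps power2_eq_square) (simp add: D_def algebra_simps)
  moreover have "0 < exp (\<alpha> * u) * ((\<alpha> - \<beta>) / \<alpha>) / D"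
    using D \<alpha> \<beta> by (intro divide_pos_pos mult_pos_pos divide_neg_neg) auto
  ultimately show "- 1 / \<beta> < boundary_slope \<alpha> \<beta> u" by simp
  have "boundary_slope \<alpha> \<beta> u + 1 / \<alpha> = - (exp (\<beta> * u) * ((\<beta> - \<alpha>) / \<beta>) / D)"
    using D \<alpha> \<beta> unfolding boundary_slope_def D_def[symmetric]
    by (simp add: field_simps power2_eq_square) (simp add: D_def algebra_simps)
  moreover have "0 < exp (\<beta> * u) * ((\<beta> - \<alpha>) / \<beta>) / D"
    using D \<alpha> \<beta> by (intro divide_pos_pos mult_pos_pos) auto
  ultimately show "boundary_slope \<alpha> \<beta> u < - 1 / \<alpha>" by simp
qed

text \<open>The hypothesis is \<open>- b\<^sub>0 < u\<close> with the threshold written out. The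
  numerator vanishes at \<open>- b\<^sub>0\<close> and is positive to the right of it, because the
  term with \<open>exp (\<beta> * u)\<close> then dominates; the prefactor
  \<open>1 / (\<alpha> * \<beta>)\<close> is negative.\<close>

lemma boundary_slope_neg:
  assumes "- (1 / (\<alpha> - \<beta>) * ln (\<beta>\<^sup>2 / \<alpha>\<^sup>2)) < u"
  shows "boundary_slope \<alpha> \<beta> u < 0"
proof -
  define b where "b = 1 / (\<alpha> - \<beta>) * ln (\<beta>\<^sup>2 / \<alpha>\<^sup>2)"
  have "(\<alpha> - \<beta>) * b = ln (\<beta>\<^sup>2 / \<alpha>\<^sup>2)" using \<alpha> \<beta> by (simp add: b_def)
  then have "\<beta>\<^sup>2 = \<alpha>\<^sup>2 * exp ((\<alpha> - \<beta>) * b)" using \<alpha> \<beta> by simp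
  then have "\<beta>\<^sup>2 * exp (\<alpha> * u) = \<alpha>\<^sup>2 * exp ((\<alpha> - \<beta>) * b + \<alpha> * u)" by (simp add: exp_add)
  also have "(\<alpha> - \<beta>) * (b + u) < 0" using assms \<alpha> \<beta> by (intro mult_neg_pos) (auto simp: b_def)
  then have "(\<alpha> - \<beta>) * b + \<alpha> * u < \<beta> * u" by (simp add: algebra_simps)
  then have "\<alpha>\<^sup>2 * exp ((\<alpha> - \<beta>) * b + \<alpha> * u) < \<alpha>\<^sup>2 * exp (\<beta> * u)" using \<alpha> by simp
  finally have "0 < \<alpha>\<^sup>2 * exp (\<beta> * u) - \<beta>\<^sup>2 * exp (\<alpha> * u)" by simp
  moreover have "1 / (\<alpha> * \<beta>) < 0" using \<alpha> \<beta> by (simp add: mult_neg_pos)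
  ultimately show ?thesis unfolding boundary_slope_def
    by (intro mult_neg_pos divide_pos_pos boundary_slope_denominator_pos)
qed

end

section \<open>Well-posedness of the boundary equation\<close>

lemma boundary_solution_iff:
  "boundary_solution \<mu> \<eta> \<rho> q b \<longleftrightarrow>
    b \<in> extensional {0..} \<and> continuous_on {0..} b \<and> b 0 = classical_threshold \<mu> \<eta> \<rho> \<and>
    (\<forall>i>0. (b has_real_derivative
      q * boundary_slope (neg_root \<mu> \<eta> \<rho>) (pos_root \<mu> \<eta> \<rho>) (i - b i)) (at i))"
  by (simp add: boundary_solution_def boundary_slope_def Let_def)

text \<open>The definite description can be used only after existence and uniqueness are both known.
  The upper bound on \<open>q\<close> keeps \<open>1 - q * g u\<close> positive, and it costs
  nothing in the limit of small \<open>q\<close>.\<close>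

lemma boundary_solution_boundary:
  assumes "\<eta> > 0" and "\<rho> > 0" and q: "0 < q" "q < - neg_root \<mu> \<eta> \<rho>"
  shows "boundary_solution \<mu> \<eta> \<rho> q (boundary \<mu> \<eta> \<rho> q)"
proof -
  define \<alpha> where "\<alpha> = neg_root \<mu> \<eta> \<rho>"
  define \<beta> where "\<beta> = pos_root \<mu> \<eta> \<rho>"
  define b\<^sub>0 where "b\<^sub>0 = classical_threshold \<mu> \<eta> \<rho>"
  define g where "g = boundary_slope \<alpha> \<beta>"
  define h where "h u = 1 - q * g u" for u
  note defs = \<alpha>_def[symmetric] \<beta>_def[symmetric] b\<^sub>0_def[symmetric] g_def[symmetric]
  have sign: "\<alpha> < 0" "0 < \<beta>" using char_poly_roots[OF assms(1,2)] by (auto simp: \<alpha>_def \<beta>_def)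
  have conth: "continuous_on UNIV h"
    unfolding h_def g_def by (intro continuous_intros continuous_boundary_slope sign)
  have posh: "0 < h u" for u
  proof -
    have "q * g u < q * (- 1 / \<alpha>)"
      unfolding g_def using boundary_slope_bounds(2)[OF sign] q by (intro mult_strict_left_mono)
    also have "\<dots> \<le> 1" using q sign by (simp add: \<alpha>_def[symmetric] field_simps)
    finally show ?thesis by (simp add: h_def)
  qed
  have bdh: "h u \<le> 1 + q / \<beta>" for u
  proof -
    have "q * (- 1 / \<beta>) < q * g u"
      unfolding g_def using boundary_slope_bounds(1)[OF sign] q by (intro mult_strict_left_mono)
    then show ?thesis by (simp add: h_def)
  qed
  obtain u where u: "u 0 = - b\<^sub>0" "\<And>t. (u has_real_derivative h (u t)) (at t)"
    using autonomous_ode_solution[OF conth posh bdh] by blast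
  \<comment> \<open>Restriction supplies the value \<open>undefined\<close> at negative arguments
    that \<open>extensional\<close> demands. At \<open>i > 0\<close> the derivative is unaffected,
    since \<open>b\<close> agrees with \<open>i - u i\<close> on a neighbourhood.\<close>
  define b where "b = restrict (\<lambda>i. i - u i) {0..}"
  have "boundary_solution \<mu> \<eta> \<rho> q b"
    unfolding boundary_solution_iff defs
  proof (intro conjI allI impI)
    show "b \<in> extensional {0..}" "b 0 = b\<^sub>0" using u(1) by (auto simp: b_def)
    have "continuous_on {0..} (\<lambda>i. i - u i)"
      using u(2) by (intro continuous_intros continuous_at_imp_continuous_on) (auto intro: DERIV_isCont)
    then show "continuous_on {0..} b"
      by (rule continuous_on_eq) (simp add: b_def)
    fix i :: real assume i: "0 < i"
    have "((\<lambda>i. i - u i) has_real_derivative q * g (i - b i)) (at i)"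
      using i by (auto intro!: derivative_eq_intros u(2) simp: b_def h_def)
    then show "(b has_real_derivative q * g (i - b i)) (at i)"
      by (rule has_field_derivative_transform_within_open[where S = "{0<..}"]) (use i in \<open>auto simp: b_def\<close>)
  qed
  \<comment> \<open>On the half-line, \<open>i - b1 i\<close> and \<open>i - b2 i\<close> solve the
    same autonomous equation from the same initial value; elsewhere \<open>extensional\<close>
    forces agreement.\<close>
  moreover have "b1 = b2" if sol: "boundary_solution \<mu> \<eta> \<rho> q b1" "boundary_solution \<mu> \<eta> \<rho> q b2" for b1 b2
  proof (rule extensionalityI)
    show "b1 \<in> extensional {0..}" "b2 \<in> extensional {0..}"
      using sol by (auto simp: boundary_solution_iff)
    have gap: "continuous_on {0..} (\<lambda>i. i - b i)"
      "0 < t \<Longrightarrow> ((\<lambda>i. i - b i) has_real_derivative h (t - b t)) (at t)"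
      if "boundary_solution \<mu> \<eta> \<rho> q b" for b t
    proof -
      note b = that[unfolded boundary_solution_iff defs]
      show "continuous_on {0..} (\<lambda>i. i - b i)" using b by (intro continuous_intros) auto
      show "((\<lambda>i. i - b i) has_real_derivative h (t - b t)) (at t)" if "0 < t"
        unfolding h_def using b that by (intro DERIV_diff DERIV_ident) auto
    qed
    fix i :: real assume "i \<in> {0..}"
    then have "0 \<le> i" by simp
    moreover have "0 - b1 0 = 0 - b2 0" using sol by (simp add: boundary_solution_iff)
    ultimately have "i - b1 i = i - b2 i"
      using autonomous_ode_unique[OF conth posh gap(1)[OF sol(1)] gap(2)[OF sol(1)]
        gap(1)[OF sol(2)] gap(2)[OF sol(2)], of i] by simp
    then show "b1 i = b2 i" by simp
  qed
  ultimately have "\<exists>!b. boundary_solution \<mu> \<eta> \<rho> q b" by blast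
  then show ?thesis unfolding boundary_def by (rule theI')
qed

text \<open>For \<open>\<mu> > 0\<close> the roots have negative sum, so the negative one is larger
  in modulus and the logarithm is negative, as is \<open>\<alpha> - \<beta>\<close>.\<close>

lemma classical_threshold_pos:
  assumes "\<eta> > 0" and "\<rho> > 0" and "\<mu> > 0"
  shows "0 < classical_threshold \<mu> \<eta> \<rho>"
proof -
  define \<alpha> where "\<alpha> = neg_root \<mu> \<eta> \<rho>"
  define \<beta> where "\<beta> = pos_root \<mu> \<eta> \<rho>"
  have sign: "\<alpha> < 0" "0 < \<beta>" "\<alpha> + \<beta> < 0"
    using char_poly_roots[OF assms(1,2)] assms(3) by (auto simp: \<alpha>_def \<beta>_def)
  have "\<beta>\<^sup>2 < (- \<alpha>)\<^sup>2" using sign by (intro power_strict_mono) auto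
  then have "ln (\<beta>\<^sup>2 / \<alpha>\<^sup>2) < 0" using sign by (intro ln_less_zero) auto
  then show ?thesis using sign unfolding classical_threshold_def \<alpha>_def[symmetric] \<beta>_def[symmetric]
    by (simp add: divide_neg_neg)
qed

section \<open>Monotonicity and bounds of the boundary, and its fixed point\<close>

context
  fixes \<mu> \<eta> \<rho> q :: real
  assumes params: "\<eta> > 0" "\<rho> > 0" "0 < q" "q < - neg_root \<mu> \<eta> \<rho>"
begin

lemma boundary_0: "boundary \<mu> \<eta> \<rho> q 0 = classical_threshold \<mu> \<eta> \<rho>"
  using boundary_solution_boundary[OF params] by (simp add: boundary_solution_iff)

lemma continuous_boundary: "0 \<le> a \<Longrightarrow> continuous_on {a..c} (boundary \<mu> \<eta> \<rho> q)"
  using boundary_solution_boundary[OF params] unfolding boundary_solution_iff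
  by (elim conjE continuous_on_subset) auto

lemma boundary_derivative:
  "0 < i \<Longrightarrow> (boundary \<mu> \<eta> \<rho> q has_real_derivative
    q * boundary_slope (neg_root \<mu> \<eta> \<rho>) (pos_root \<mu> \<eta> \<rho>) (i - boundary \<mu> \<eta> \<rho> q i)) (at i)"
  using boundary_solution_boundary[OF params] by (simp add: boundary_solution_iff)

lemma boundary_gap_strict_mono:
  assumes "0 \<le> i" and "i < j"
  shows "i - boundary \<mu> \<eta> \<rho> q i < j - boundary \<mu> \<eta> \<rho> q j"
proof (rule DERIV_pos_imp_increasing_open[OF assms(2)])
  fix x assume "i < x" "x < j"
  let ?s = "boundary_slope (neg_root \<mu> \<eta> \<rho>) (pos_root \<mu> \<eta> \<rho>) (x - boundary \<mu> \<eta> \<rho> q x)"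
  have neg: "neg_root \<mu> \<eta> \<rho> < 0" using char_poly_roots params by blast
  have "q * ?s < q * (- 1 / neg_root \<mu> \<eta> \<rho>)"
    using boundary_slope_bounds(2) char_poly_roots params by (intro mult_strict_left_mono) auto
  also have "\<dots> \<le> 1" using params neg by (simp add: field_simps)
  finally have "0 < 1 - q * ?s" by simp
  moreover have "((\<lambda>x. x - boundary \<mu> \<eta> \<rho> q x) has_real_derivative 1 - q * ?s) (at x)"
    using \<open>i < x\<close> assms by (auto intro!: derivative_eq_intros boundary_derivative)
  ultimately show "\<exists>y. ((\<lambda>x. x - boundary \<mu> \<eta> \<rho> q x) has_real_derivative y) (at x) \<and> 0 < y" by blast
qed (intro continuous_intros continuous_boundary assms)

text \<open>The gap starts at \<open>- b\<^sub>0\<close>, the zero of \<open>g\<close>, and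
  increases, so \<open>g\<close> is negative along the solution and the boundary falls from its
  initial value.\<close>

lemma boundary_less_threshold:
  assumes "0 < i"
  shows "boundary \<mu> \<eta> \<rho> q i < classical_threshold \<mu> \<eta> \<rho>"
proof -
  have "boundary \<mu> \<eta> \<rho> q i < boundary \<mu> \<eta> \<rho> q 0"
  proof (rule DERIV_neg_imp_decreasing_open[OF assms])
    fix x :: real assume "0 < x"
    let ?s = "boundary_slope (neg_root \<mu> \<eta> \<rho>) (pos_root \<mu> \<eta> \<rho>) (x - boundary \<mu> \<eta> \<rho> q x)"
    have "?s < 0"
      using boundary_gap_strict_mono[OF _ \<open>0 < x\<close>] char_poly_roots[OF params(1,2), of \<mu>]
      by (intro boundary_slope_neg) (auto simp: boundary_0 classical_threshold_def Let_def)
    then have "q * ?s < 0" using params by (intro mult_pos_neg)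
    then show "\<exists>y. (boundary \<mu> \<eta> \<rho> q has_real_derivative y) (at x) \<and> y < 0"
      using boundary_derivative[OF \<open>0 < x\<close>] by blast
  qed (intro continuous_boundary order_refl)
  then show ?thesis by (simp add: boundary_0)
qed

lemma boundary_le_threshold: "0 \<le> i \<Longrightarrow> boundary \<mu> \<eta> \<rho> q i \<le> classical_threshold \<mu> \<eta> \<rho>"
  using boundary_less_threshold[of i] boundary_0 by (cases "i = 0") auto

text \<open>The lower bound \<open>- 1 / \<beta>\<close> on the slope makes
  \<open>b i + q * i / \<beta>\<close> nondecreasing. This estimate drives both limits
  below.\<close>

lemma boundary_ge:
  assumes "0 \<le> i"
  shows "classical_threshold \<mu> \<eta> \<rho> - q * i / pos_root \<mu> \<eta> \<rho> \<le> boundary \<mu> \<eta> \<rho> q i"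
proof -
  let ?\<beta> = "pos_root \<mu> \<eta> \<rho>"
  have "boundary \<mu> \<eta> \<rho> q 0 + q * 0 / ?\<beta> \<le> boundary \<mu> \<eta> \<rho> q i + q * i / ?\<beta>"
  proof (rule DERIV_nonneg_imp_increasing_open[OF assms])
    fix x :: real assume "0 < x"
    let ?s = "boundary_slope (neg_root \<mu> \<eta> \<rho>) ?\<beta> (x - boundary \<mu> \<eta> \<rho> q x)"
    have "q * (- 1 / ?\<beta>) < q * ?s"
      using boundary_slope_bounds(1) char_poly_roots params by (intro mult_strict_left_mono) auto
    then have "0 \<le> q * ?s + q / ?\<beta>" by simp
    moreover have "((\<lambda>x. boundary \<mu> \<eta> \<rho> q x + q * x / ?\<beta>) has_real_derivative q * ?s + q / ?\<beta>) (at x)"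
      using boundary_derivative[OF \<open>0 < x\<close>] char_poly_roots(2)[OF params(1,2), of \<mu>]
      by (auto intro!: derivative_eq_intros)
    ultimately show "\<exists>y. ((\<lambda>x. boundary \<mu> \<eta> \<rho> q x + q * x / ?\<beta>) has_real_derivative y) (at x) \<and> 0 \<le> y"
      by blast
  qed (use char_poly_roots(2)[OF params(1,2), of \<mu>] in
      \<open>auto intro!: continuous_intros continuous_boundary\<close>)
  then show ?thesis by (simp add: boundary_0)
qed

text \<open>The continuous function \<open>i - b i\<close> is negative at 0 and positive at the
  threshold, hence has a zero strictly between them; strict monotonicity makes it the only
  one.\<close>

lemma i_star_fixed_point:
  assumes "\<mu> > 0"
  shows "0 < i_star \<mu> \<eta> \<rho> q" and "i_star \<mu> \<eta> \<rho> q < classical_threshold \<mu> \<eta> \<rho>"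
    and "boundary \<mu> \<eta> \<rho> q (i_star \<mu> \<eta> \<rho> q) = i_star \<mu> \<eta> \<rho> q"
proof -
  define c where "c = classical_threshold \<mu> \<eta> \<rho>"
  have c: "0 < c" unfolding c_def using classical_threshold_pos params assms by blast
  have "\<exists>i\<ge>0. i \<le> c \<and> i - boundary \<mu> \<eta> \<rho> q i = 0"
    using c boundary_less_threshold[OF c]
    by (intro IVT') (auto simp: boundary_0 c_def[symmetric] intro!: continuous_intros continuous_boundary)
  then obtain i where i: "0 \<le> i" "i \<le> c" "boundary \<mu> \<eta> \<rho> q i = i" by auto
  moreover have "i \<noteq> 0" "i \<noteq> c"
    using i boundary_0 boundary_less_threshold[OF c] c by (auto simp: c_def)
  ultimately have "i \<in> {0<..<c} \<and> boundary \<mu> \<eta> \<rho> q i = i" by auto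
  moreover have "j = i" if "j \<in> {0<..<c} \<and> boundary \<mu> \<eta> \<rho> q j = j" for j
    using boundary_gap_strict_mono[of i j] boundary_gap_strict_mono[of j i] i that
    by (cases i j rule: linorder_cases) auto
  ultimately have "i_star \<mu> \<eta> \<rho> q \<in> {0<..<c} \<and>
      boundary \<mu> \<eta> \<rho> q (i_star \<mu> \<eta> \<rho> q) = i_star \<mu> \<eta> \<rho> q"
    unfolding i_star_def c_def[symmetric] by (rule theI)
  then show "0 < i_star \<mu> \<eta> \<rho> q" "i_star \<mu> \<eta> \<rho> q < classical_threshold \<mu> \<eta> \<rho>"
    "boundary \<mu> \<eta> \<rho> q (i_star \<mu> \<eta> \<rho> q) = i_star \<mu> \<eta> \<rho> q"
    by (auto simp: c_def)
qed

end

section \<open>Limits as \<open>q\<close> decreases to 0\<close>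

lemma eventually_small_penalty:
  assumes "\<eta> > 0" and "\<rho> > 0"
  shows "\<forall>\<^sub>F q in at_right 0. 0 < q \<and> q < - neg_root \<mu> \<eta> \<rho>"
  using eventually_at_right_less[of 0] eventually_at_right_real[of 0 "- neg_root \<mu> \<eta> \<rho>"]
    char_poly_roots(1)[OF assms, of \<mu>] by (auto elim: eventually_mono)

lemma tendsto_boundary:
  assumes "\<eta> > 0" and "\<rho> > 0" and "0 \<le> i"
  shows "((\<lambda>q. boundary \<mu> \<eta> \<rho> q i) \<longlongrightarrow> classical_threshold \<mu> \<eta> \<rho>) (at_right 0)"
proof (rule tendsto_sandwich)
  show "\<forall>\<^sub>F q in at_right 0. classical_threshold \<mu> \<eta> \<rho> - q * i / pos_root \<mu> \<eta> \<rho> \<le> boundary \<mu> \<eta> \<rho> q i"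
    using eventually_small_penalty[OF assms(1,2), of \<mu>]
    by eventually_elim (use assms boundary_ge in auto)
  show "\<forall>\<^sub>F q in at_right 0. boundary \<mu> \<eta> \<rho> q i \<le> classical_threshold \<mu> \<eta> \<rho>"
    using eventually_small_penalty[OF assms(1,2), of \<mu>]
    by eventually_elim (use assms boundary_le_threshold in auto)
  show "((\<lambda>q. classical_threshold \<mu> \<eta> \<rho> - q * i / pos_root \<mu> \<eta> \<rho>) \<longlongrightarrow> classical_threshold \<mu> \<eta> \<rho>)
      (at_right 0)"
    using char_poly_roots(2)[OF assms(1,2), of \<mu>] by (auto intro!: tendsto_eq_intros)
qed simp

text \<open>At the fixed point \<open>boundary_ge\<close> bounds \<open>i_star\<close> itself from
  below. Replacing \<open>i_star\<close> by the larger threshold in the error term gives a bound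
  explicit in \<open>q\<close>.\<close>

lemma tendsto_i_star:
  assumes "\<eta> > 0" and "\<rho> > 0" and "\<mu> > 0"
  shows "(i_star \<mu> \<eta> \<rho> \<longlongrightarrow> classical_threshold \<mu> \<eta> \<rho>) (at_right 0)"
proof (rule tendsto_sandwich)
  let ?c = "classical_threshold \<mu> \<eta> \<rho>" and ?\<beta> = "pos_root \<mu> \<eta> \<rho>"
  have \<beta>: "0 < ?\<beta>" using char_poly_roots(2)[OF assms(1,2)] .
  show "\<forall>\<^sub>F q in at_right 0. ?c - q * ?c / ?\<beta> \<le> i_star \<mu> \<eta> \<rho> q"
    using eventually_small_penalty[OF assms(1,2), of \<mu>]
  proof eventually_elim
    case (elim q)
    note s = i_star_fixed_point[OF assms(1,2) conjunct1[OF elim] conjunct2[OF elim] assms(3)]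
    have "q * i_star \<mu> \<eta> \<rho> q / ?\<beta> \<le> q * ?c / ?\<beta>"
      using s(2) elim \<beta> by (intro divide_right_mono mult_left_mono) auto
    moreover have "?c - q * i_star \<mu> \<eta> \<rho> q / ?\<beta> \<le> i_star \<mu> \<eta> \<rho> q"
      using boundary_ge[of \<eta> \<rho> q \<mu> "i_star \<mu> \<eta> \<rho> q"] assms elim s by simp
    ultimately show ?case by linarith
  qed
  show "\<forall>\<^sub>F q in at_right 0. i_star \<mu> \<eta> \<rho> q \<le> ?c"
    using eventually_small_penalty[OF assms(1,2), of \<mu>]
    by eventually_elim (use assms i_star_fixed_point(2) less_imp_le in blast)
  show "((\<lambda>q. ?c - q * ?c / ?\<beta>) \<longlongrightarrow> ?c) (at_right 0)"
    using \<beta> by (auto intro!: tendsto_eq_intros)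
qed simp

text \<open>This controls the singular terms \<open>1 / q\<close> of the value function. For
  \<open>q > 0\<close> the quotient equals \<open>s q * \<phi> (q * s q)\<close>, where
  \<open>\<phi>\<close> is the continuous extension of \<open>(1 - exp (- y)) / y\<close> and so
  also covers \<open>s q = 0\<close>.\<close>

lemma tendsto_exp_difference_quotient:
  fixes s :: "real \<Rightarrow> real"
  assumes "(s \<longlongrightarrow> c) (at_right 0)"
  shows "((\<lambda>q. (1 - exp (- q * s q)) / q) \<longlongrightarrow> c) (at_right 0)"
proof -
  define \<phi> :: "real \<Rightarrow> real" where "\<phi> y = (if y = 0 then 1 else (1 - exp (- y)) / y)" for y
  have "((\<lambda>y::real. (1 - exp (- y)) / y) \<longlongrightarrow> 1) (at 0)" by real_asymp
  then have "(\<phi> \<longlongrightarrow> 1) (at 0)"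
    by (rule Lim_transform_eventually) (auto simp: \<phi>_def eventually_at intro!: exI[of _ 1])
  then have "isCont \<phi> 0" by (simp add: isCont_def \<phi>_def)
  moreover have "((\<lambda>q. q * s q) \<longlongrightarrow> 0) (at_right 0)"
    using assms by (auto intro!: tendsto_eq_intros)
  ultimately have "((\<lambda>q. \<phi> (q * s q)) \<longlongrightarrow> \<phi> 0) (at_right 0)" by (rule isCont_tendsto_compose)
  then have "((\<lambda>q. s q * \<phi> (q * s q)) \<longlongrightarrow> c) (at_right 0)"
    using tendsto_mult[OF assms] by (fastforce simp: \<phi>_def)
  then show ?thesis
    by (rule Lim_transform_eventually)
       (use eventually_at_right_less[of 0] in eventually_elim, auto simp: \<phi>_def)
qed

theorem proposition5p7:
  fixes \<mu> \<eta> \<rho> :: real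
  assumes "\<eta> > 0" and "\<rho> > 0"
  shows "(\<mu> > 0 \<longrightarrow>
            (\<forall>i\<ge>0. ((\<lambda>q. boundary \<mu> \<eta> \<rho> q i) \<longlongrightarrow> classical_threshold \<mu> \<eta> \<rho>) (at_right 0))) \<and>
         (\<forall>(x, i) \<in> state_space.
            ((\<lambda>q. value_fn \<mu> \<eta> \<rho> q x i) \<longlongrightarrow> classical_value \<mu> \<eta> \<rho> x) (at_right 0))"
proof -
  define \<alpha> where "\<alpha> = neg_root \<mu> \<eta> \<rho>"
  define \<beta> where "\<beta> = pos_root \<mu> \<eta> \<rho>"
  define c where "c = classical_threshold \<mu> \<eta> \<rho>"
  define b where "b = boundary \<mu> \<eta> \<rho>"
  define s where "s = i_star \<mu> \<eta> \<rho>"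
  note defs = \<alpha>_def[symmetric] \<beta>_def[symmetric] c_def[symmetric] b_def[symmetric] s_def[symmetric]
  have sign: "\<alpha> < 0" "0 < \<beta>" using char_poly_roots[OF assms] by (auto simp: \<alpha>_def \<beta>_def)
  note small = eventually_small_penalty[OF assms, of \<mu>]
  have "((\<lambda>q. value_fn \<mu> \<eta> \<rho> q x i) \<longlongrightarrow> classical_value \<mu> \<eta> \<rho> x) (at_right 0)"
    if i: "0 \<le> i" "i \<le> x" for x i
  proof (cases "\<mu> \<le> 0")
    case True
    \<comment> \<open>The two terms in \<open>1 / q\<close> are merged into a difference quotient
      with limit \<open>i\<close>, so the total is \<open>(x - i) + i\<close>.\<close>
    have "((\<lambda>q. exp (- q * i) * (x - i) + (1 - exp (- q * i)) / q) \<longlongrightarrow> x) (at_right 0)"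
      by (rule tendsto_eq_intros tendsto_exp_difference_quotient tendsto_const refl | simp)+
    then show ?thesis
      by (rule Lim_transform_eventually[THEN tendsto_eq_rhs])
         (use True in \<open>auto simp: value_fn_def classical_value_def algebra_simps diff_divide_distrib\<close>)
  next
    case False
    then have \<mu>: "0 < \<mu>" by simp
    have b: "((\<lambda>q. b q i) \<longlongrightarrow> c) (at_right 0)"
      unfolding b_def c_def using assms i(1) by (rule tendsto_boundary)
    have s: "(s \<longlongrightarrow> c) (at_right 0)"
      unfolding s_def c_def using assms \<mu> by (rule tendsto_i_star)
    \<comment> \<open>Convergence alone does not settle the branch when \<open>x = c\<close> or
      \<open>i = c\<close>; this one-sided bound does, in the last case together with
      \<open>s q \<le> c\<close>.\<close>
    have b_le: "\<forall>\<^sub>F q in at_right 0. b q i \<le> c"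
      using small by eventually_elim (use assms i boundary_le_threshold in \<open>auto simp: b_def c_def\<close>)
    consider "x < c" | "c \<le> x" "i < c" | "c \<le> x" "c \<le> i" by linarith
    then show ?thesis
    proof cases
      case 1
      have "((\<lambda>q. 1 / (\<alpha> - \<beta>) * exp (- q * i) *
          (\<alpha> / \<beta> * exp (\<beta> * (x - b q i)) - \<beta> / \<alpha> * exp (\<alpha> * (x - b q i)))) \<longlongrightarrow>
          1 / (\<alpha> - \<beta>) * exp (- 0 * i) *
          (\<alpha> / \<beta> * exp (\<beta> * (x - c)) - \<beta> / \<alpha> * exp (\<alpha> * (x - c)))) (at_right 0)"
        by (intro tendsto_intros b)
      also have "1 / (\<alpha> - \<beta>) * exp (- 0 * i) *
          (\<alpha> / \<beta> * exp (\<beta> * (x - c)) - \<beta> / \<alpha> * exp (\<alpha> * (x - c))) = classical_value \<mu> \<eta> \<rho> x"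
        using False 1 unfolding classical_value_def Let_def defs
        by (simp add: right_diff_distrib mult_ac)
      finally show ?thesis
        by (rule Lim_transform_eventually)
           (use order_tendstoD(1)[OF b 1] in eventually_elim,
            use False i in \<open>auto simp: value_fn_def Let_def defs\<close>)
    next
      case 2
      have "((\<lambda>q. exp (- q * i) * (x - b q i + \<mu> / \<rho>)) \<longlongrightarrow> exp (- 0 * i) * (x - c + \<mu> / \<rho>))
          (at_right 0)"
        by (intro tendsto_intros b)
      also have "exp (- 0 * i) * (x - c + \<mu> / \<rho>) = classical_value \<mu> \<eta> \<rho> x"
        using False 2 unfolding classical_value_def Let_def defs by simp
      finally show ?thesis
        by (rule Lim_transform_eventually)
           (use order_tendstoD(1)[OF b 2(2)] order_tendstoD(1)[OF s 2(2)] b_le in eventually_elim,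
            use False i 2 in \<open>auto simp: value_fn_def Let_def defs\<close>)
    next
      case 3
      \<comment> \<open>Each of the two divergent terms is paired with a \<open>1 / q\<close> that
        cancels in the difference. The quotients tend to \<open>i\<close> and \<open>c\<close>, and
        \<open>(x - i) + \<mu> / \<rho> + (i - c)\<close> no longer depends on
        \<open>i\<close>.\<close>
      have "((\<lambda>q. exp (- q * i) * (x - i) + \<mu> / \<rho> * exp (- q * s q) +
            ((1 - exp (- q * i)) / q - (1 - exp (- q * s q)) / q)) \<longlongrightarrow>
          exp (- 0 * i) * (x - i) + \<mu> / \<rho> * exp (- 0 * c) + (i - c)) (at_right 0)"
        by (intro tendsto_intros s tendsto_exp_difference_quotient)
      also have "exp (- 0 * i) * (x - i) + \<mu> / \<rho> * exp (- 0 * c) + (i - c) = classical_value \<mu> \<eta> \<rho> x"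
        using False 3 unfolding classical_value_def Let_def defs by simp
      finally show ?thesis
      proof (rule Lim_transform_eventually)
        have "\<forall>\<^sub>F q in at_right 0. s q \<le> c"
          using small unfolding s_def c_def
          by eventually_elim (use assms \<mu> i_star_fixed_point(2) less_imp_le in blast)
        then show "\<forall>\<^sub>F q in at_right 0. exp (- q * i) * (x - i) + \<mu> / \<rho> * exp (- q * s q) +
            ((1 - exp (- q * i)) / q - (1 - exp (- q * s q)) / q) = value_fn \<mu> \<eta> \<rho> q x i"
          using b_le small
        proof eventually_elim
          case (elim q)
          then have "value_fn \<mu> \<eta> \<rho> q x i =
              exp (- q * i) * (x - i - 1 / q) + (1 / q + \<mu> / \<rho>) * exp (- q * s q)"
            using False i 3 by (auto simp: value_fn_def Let_def defs)
          then show ?case by (simp add: algebra_simps diff_divide_distrib)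
        qed
      qed
    qed
  qed
  then show ?thesis using tendsto_boundary[OF assms] by (auto simp: state_space_def)
qed

end
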